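(* Let $m$ be any positive integer. Then $p^m$ is arithmetic for every odd prime $p$ if and only if $m$ is a Mersenne number.
   Context: A positive integer $n$ is called arithmetic if the arithmetic mean of its positive divisors, $A(n)=\sigma(n)/\tau(n)$, is an integer. A Mersenne number is a number of the form $2^t-1$ with $t\ge 1$ an integer ($t$ not required to be prime), i.e. a positive integer $m$ such that $m+1$ is a power of $2$. *)

theory Defs
  imports Complex_Main "HOL-Computational_Algebra.Primes"
begin

definition divisor_sum :: "nat \<Rightarrow> nat" where
  "divisor_sum n = (\<Sum>d | d dvd n. d)"

definition divisor_count :: "nat \<Rightarrow> nat" where
  "divisor_count n = card {d. d dvd n}"

definition divisor_mean :: "nat \<Rightarrow> rat" where
  "divisor_mean n = of_nat (divisor_sum n) / of_nat (divisor_count n)"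

(* Positivity is needed: 0 has infinitely many divisors, so divisor_mean 0 = 0 by convention. *)
definition arithmetic_number :: "nat \<Rightarrow> bool" where
  "arithmetic_number n \<longleftrightarrow> n > 0 \<and> divisor_mean n \<in> \<int>"

(* The exponent need not be prime; since 2 ^ t \<ge> 1, the subtraction does not truncate. *)
definition mersenne_number :: "nat \<Rightarrow> bool" where
  "mersenne_number m \<longleftrightarrow> (\<exists>t\<ge>1. m = 2 ^ t - 1)"

end

theory Submission
  imports Defs
begin

text \<open>
  The divisors of a prime power \<open>p ^ m\<close> are \<open>1, p, \<dots>, p ^ m\<close>, so \<open>p ^ m\<close> is arithmetic exactly when
  \<open>m + 1\<close> divides \<open>1 + p + \<dots> + p ^ m\<close>.

  If \<open>m + 1 = 2 ^ t\<close>, this sum is the product of the factors \<open>1 + p ^ (2 ^ j)\<close> with \<open>j < t\<close>, each of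
  which is even for odd \<open>p\<close>; this is \<open>power_of_two_dvd_geometric_sum\<close>.

  If \<open>m + 1\<close> is not a power of two, it has an odd prime factor \<open>q\<close>, and \<open>p = q\<close> itself is a
  counterexample: \<open>1 + q + \<dots> + q ^ m\<close> is \<open>1\<close> modulo \<open>q\<close>, so not even the factor \<open>q\<close> of \<open>m + 1\<close>
  divides it.
\<close>

lemma arithmetic_number_iff_dvd:
  "arithmetic_number n \<longleftrightarrow> n > 0 \<and> divisor_count n dvd divisor_sum n"
proof (cases "n > 0")
  case True
  then have "divisor_count n \<noteq> 0"
    unfolding divisor_count_def by (subst card_0_eq) auto
  then show ?thesis
    using of_int_div_of_int_in_Ints_iff
      [where ?'a = rat, of "int (divisor_sum n)" "int (divisor_count n)"]
    by (simp add: arithmetic_number_def divisor_mean_def)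
qed (simp add: arithmetic_number_def)

lemma divisors_prime_power:
  fixes p :: nat
  assumes "prime p"
  shows "{d. d dvd p ^ m} = (\<lambda>i. p ^ i) ` {..m}"
  using divides_primepow_nat[OF assms] by auto

lemma arithmetic_prime_power_iff:
  fixes p :: nat
  assumes "prime p"
  shows "arithmetic_number (p ^ m) \<longleftrightarrow> m + 1 dvd (\<Sum>i<m + 1. p ^ i)"
proof -
  have "inj_on (\<lambda>i. p ^ i) {..m}"
    using prime_gt_1_nat[OF assms] by (auto intro: inj_onI)
  then have "divisor_count (p ^ m) = m + 1" "divisor_sum (p ^ m) = (\<Sum>i<m + 1. p ^ i)"
    using assms
    by (simp_all add: divisor_count_def divisor_sum_def divisors_prime_power card_image
        sum.reindex lessThan_Suc_atMost)
  then show ?thesis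
    using prime_gt_0_nat[OF assms] by (simp add: arithmetic_number_iff_dvd)
qed

lemma geometric_sum_double:
  fixes x :: "'a::comm_semiring_1"
  shows "(\<Sum>i<2 * n. x ^ i) = (1 + x ^ n) * (\<Sum>i<n. x ^ i)"
proof -
  have "(\<Sum>i<n + k. x ^ i) = (\<Sum>i<n. x ^ i) + (\<Sum>i<k. x ^ (n + i))" for k
    by (induction k) (simp_all add: add.assoc)
  from this[of n] show ?thesis
    by (simp add: mult_2 power_add distrib_right flip: sum_distrib_left)
qed

text \<open>
  Splitting the sum in half, as in \<open>geometric_sum_double\<close>, takes out the even factor \<open>1 + p ^ (2 ^ t)\<close>
  at each step of the induction.
\<close>
lemma power_of_two_dvd_geometric_sum:
  fixes p :: nat
  assumes "odd p"
  shows "2 ^ t dvd (\<Sum>i<2 ^ t. p ^ i)"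
proof (induction t)
  case (Suc t)
  have "2 dvd 1 + p ^ (2 ^ t)"
    using assms by simp
  then have "2 * 2 ^ t dvd (1 + p ^ (2 ^ t)) * (\<Sum>i<2 ^ t. p ^ i)"
    using Suc.IH by (rule mult_dvd_mono)
  then show ?case
    by (simp add: geometric_sum_double)
qed simp

lemma not_dvd_geometric_sum:
  fixes q :: nat
  assumes "prime q"
  shows "\<not> q dvd (\<Sum>i<Suc m. q ^ i)"
proof -
  have "(\<Sum>i<Suc m. q ^ i) = 1 + q * (\<Sum>i<m. q ^ i)"
    by (simp only: sum.lessThan_Suc_shift) (simp add: sum_distrib_left)
  moreover have "\<not> q dvd 1 + q * (\<Sum>i<m. q ^ i)"
    using prime_gt_1_nat[OF assms] by (metis One_nat_def dvd_add_left_iff dvd_triv_left nat_dvd_1_iff_1 less_numeral_extra(4))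
  ultimately show ?thesis by metis
qed

lemma power_of_two_or_odd_prime_factor:
  fixes n :: nat
  assumes "n > 0"
  obtains t where "n = 2 ^ t" | q where "prime q" "odd q" "q dvd n"
proof -
  obtain x where x: "n = 2 ^ multiplicity 2 n * x" "odd x"
    using multiplicity_decompose'[of n 2] assms by auto
  show thesis
  proof (cases "x = 1")
    case True
    then show thesis using x(1) that(1) by simp
  next
    case False
    then obtain q where "prime q" "q dvd x"
      using prime_factor_nat by blast
    moreover have "odd q"
      using \<open>q dvd x\<close> x(2) dvd_trans by blast
    ultimately show thesis
      using x(1) that(2) by (metis dvd_mult)
  qed
qed

theorem corollary1:
  fixes m :: nat
  assumes "m > 0"
  shows "(\<forall>p::nat. prime p \<and> odd p \<longrightarrow> arithmetic_number (p ^ m)) \<longleftrightarrow> mersenne_number m"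
proof
  assume arith: "\<forall>p::nat. prime p \<and> odd p \<longrightarrow> arithmetic_number (p ^ m)"
  have "m + 1 > 0" by simp
  then show "mersenne_number m"
  proof (cases rule: power_of_two_or_odd_prime_factor)
    case (1 t)
    have "t \<ge> 1"
      using 1 assms by (cases t) auto
    moreover have "m = 2 ^ t - 1"
      using 1 by simp
    ultimately show ?thesis
      unfolding mersenne_number_def by blast
  next
    case (2 q)
    then have "m + 1 dvd (\<Sum>i<m + 1. q ^ i)"
      using arith arithmetic_prime_power_iff by blast
    then have "q dvd (\<Sum>i<Suc m. q ^ i)"
      using \<open>q dvd m + 1\<close> dvd_trans by simp
    then show ?thesis
      using not_dvd_geometric_sum[OF \<open>prime q\<close>] by blast
  qed
next
  assume "mersenne_number m"
  then obtain t where "m + 1 = 2 ^ t"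
    unfolding mersenne_number_def by auto
  then show "\<forall>p::nat. prime p \<and> odd p \<longrightarrow> arithmetic_number (p ^ m)"
    using arithmetic_prime_power_iff power_of_two_dvd_geometric_sum by metis
qed

end
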